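(* Let $D_{1,K}$ be the number of pairs of consecutive roots at distance $1$ in the ballistic deposition process on the cyclic strip $[K]$. Then $\frac{15\,D_{1,K}}{2K}$ converges to $1$ in probability as $K\to\infty$.
   Context: Ballistic deposition on a strip: for an integer $K\ge 3$ let $[K]=\{1,\dots,K\}$, and define the (cyclic) neighbour sets $I(1)=\{K,1,2\}$, $I(k)=\{k-1,k,k+1\}$ for $2\le k\le K-1$, and $I(K)=\{K-1,K,1\}$. Let $(X_n)_{n\ge 0}$ be i.i.d. random variables uniformly distributed on $[K]$. Define random height functions $H_n:[K]\to\{0,1,2,\dots\}$ by $H_0(k)=0$ for all $k\in[K]$ and, for $n\ge 1$, $H_n(k)=H_{n-1}(k)$ if $X_n\ne k$, and $H_n(k)=\max_{j\in I(k)}H_{n-1}(j)+1$ if $X_n=k$. The set of roots eventually formed is $\mathcal R^{[K]}=\{k\in[K]: H_i(k)=1 \text{ for some } i\ge 1\}$, and $R^{[K]}=\mathrm{Card}(\mathcal R^{[K]})$. Let $r_1<\cdots<r_{R^{[K]}}$ be the ordered locations of the roots. For $1\le i\le K-1$ let $D_{i,K}=\sum_{j=1}^{R^{[K]}-1}\mathbf 1_{\{r_{j+1}-r_j=i+1\}}+\mathbf 1_{\{r_{R^{[K]}}-r_1=K-i-1\}}$ be the number of pairs of (cyclically) consecutive roots with distance $i$ (that is, $i$ non-root sites) between them. *)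

theory Defs
  imports "HOL-Probability.Probability"
begin

definition nbhd :: "nat \<Rightarrow> nat \<Rightarrow> nat set" where
  "nbhd K k = (if k = 1 then {K, 1, 2} else if k = K then {K - 1, K, 1} else {k - 1, k, k + 1})"

text \<open>The heights driven by a realisation x of the sequence of positions;
  the entry x 0 is not used.\<close>

fun height :: "nat \<Rightarrow> (nat \<Rightarrow> nat) \<Rightarrow> nat \<Rightarrow> nat \<Rightarrow> nat" where
  "height K x 0 k = 0"
| "height K x (Suc n) k =
    (if x (Suc n) = k then Max (height K x n ` nbhd K k) + 1 else height K x n k)"

definition roots :: "nat \<Rightarrow> (nat \<Rightarrow> nat) \<Rightarrow> nat set" where
  "roots K x = {k \<in> {1..K}. \<exists>i\<ge>1. height K x i k = 1}"

definition num_roots :: "nat \<Rightarrow> (nat \<Rightarrow> nat) \<Rightarrow> nat" where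
  "num_roots K x = card (roots K x)"

text \<open>The j-th smallest root, for j from 1 to the number of roots.\<close>

definition root_loc :: "nat \<Rightarrow> (nat \<Rightarrow> nat) \<Rightarrow> nat \<Rightarrow> nat" where
  "root_loc K x j = sorted_list_of_set (roots K x) ! (j - 1)"

text \<open>Meant for i between 1 and K - 1 and x with values in {1..K}. Then there is at least one
  root (the site x 1) and the roots are listed increasingly, so no subtraction truncates.\<close>

definition num_gaps :: "nat \<Rightarrow> nat \<Rightarrow> (nat \<Rightarrow> nat) \<Rightarrow> nat" where
  "num_gaps i K x =
    (\<Sum>j = 1..num_roots K x - 1. of_bool (root_loc K x (j + 1) - root_loc K x j = i + 1))
    + of_bool (root_loc K x (num_roots K x) - root_loc K x 1 = K - i - 1)"

end

theory Submission
  imports Defs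
begin

text \<open>
  Let \<open>T k\<close> be the first time at which a particle falls on site \<open>k\<close>. The height of a site is
  positive exactly from its first visit on, so once every site has been visited (which happens
  almost surely) the roots are the strict local minima of \<open>T\<close> on the cycle
  (\<open>root_iff_first_visited\<close>). Two roots are never adjacent. Hence the gaps with one non-root site
  correspond, up to the two ends of the strip and the cyclic term, to the positions \<open>a\<close> at which
  both \<open>a + 1\<close> and \<open>a + 3\<close> are local minima within the window \<open>{a..a + 4}\<close>, called zigzags below
  (\<open>num_gaps_near_zigzags\<close>).

  The law of \<open>T\<close> does not change when sites are permuted, because relabelling the sites preserves
  the law of an i.i.d. uniform sequence (\<open>prob_T_permuted\<close>). By symmetry every site of a finite set
  \<open>S\<close> is equally likely to be the first one visited in \<open>S\<close>, even given an event that ignores the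
  order within \<open>S\<close> (\<open>prob_first_in\<close>). In a zigzag the earliest of the five sites is \<open>a + 1\<close> or
  \<open>a + 3\<close>, which has probability \<open>1/5\<close> each, and then the other valley must be the earliest of its
  three-site neighbourhood, which has probability \<open>1/3\<close>. This gives \<open>2 \<sqdot> 1/5 \<sqdot> 1/3 = 2/15\<close>, and the
  same argument shows that zigzags in disjoint windows are uncorrelated (\<open>prob_zigzag\<close>).

  The number of zigzags therefore has mean \<open>2/15 (K - 4)\<close> and variance at most \<open>9 K\<close>, since each
  window meets at most nine windows, itself included. Chebyshev's inequality finishes the proof.
\<close>

section \<open>Roots are the local minima of the first-visit times\<close>

text \<open>Time \<open>0\<close> is skipped because the particles are numbered from \<open>1\<close>. The value for a site that
  is never visited is arbitrary.\<close>

definition first_visit :: "(nat \<Rightarrow> nat) \<Rightarrow> nat \<Rightarrow> nat" where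
  "first_visit x k = (LEAST n. 1 \<le> n \<and> x n = k)"

lemma first_visit_props:
  assumes "\<exists>n\<ge>1. x n = k"
  shows first_visit_pos: "1 \<le> first_visit x k"
    and at_first_visit: "x (first_visit x k) = k"
proof -
  from assms obtain n where "1 \<le> n \<and> x n = k"
    by blast
  then have "1 \<le> first_visit x k \<and> x (first_visit x k) = k"
    unfolding first_visit_def by (rule LeastI)
  then show "1 \<le> first_visit x k" "x (first_visit x k) = k"
    by auto
qed

lemma first_visit_le: "1 \<le> n \<Longrightarrow> x n = k \<Longrightarrow> first_visit x k \<le> n"
  unfolding first_visit_def by (rule Least_le) simp

lemma inj_on_first_visit:
  assumes "\<forall>k\<in>A. \<exists>n\<ge>1. x n = k"
  shows "inj_on (first_visit x) A"
proof (rule inj_onI)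
  fix k l assume "k \<in> A" "l \<in> A" "first_visit x k = first_visit x l"
  then show "k = l"
    using assms by (metis at_first_visit)
qed

text \<open>The relabelled sequence visits \<open>\<pi> k\<close> exactly when the original one visits \<open>k\<close>, so both values
  of \<open>LEAST\<close> agree even if there is no visit at all.\<close>

lemma first_visit_relabel:
  assumes "inj \<pi>"
  shows "first_visit (\<lambda>n. \<pi> (x n)) (\<pi> k) = first_visit x k"
  using assms by (simp add: first_visit_def inj_eq)

lemma height_pos_iff:
  assumes "\<exists>n\<ge>1. x n = k"
  shows "0 < height K x i k \<longleftrightarrow> first_visit x k \<le> i"
proof (induction i)
  case 0
  then show ?case
    using first_visit_pos[OF assms] by simp
next
  case (Suc i)
  show ?case
  proof (cases "x (Suc i) = k")
    case True
    then show ?thesis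
      using first_visit_le[of "Suc i" x k] by simp
  next
    case False
    then have "first_visit x k \<noteq> Suc i"
      using at_first_visit[OF assms] by auto
    then show ?thesis
      using Suc False by auto
  qed
qed

lemma finite_nbhd [simp]: "finite (nbhd K k)"
  by (simp add: nbhd_def)

lemma nbhd_self: "k \<in> nbhd K k"
  by (simp add: nbhd_def)

lemma height_mono:
  assumes "i \<le> i'"
  shows "height K x i k \<le> height K x i' k"
  using assms
proof (induction i' rule: dec_induct)
  case (step n)
  have "height K x n k \<le> Max (height K x n ` nbhd K k)"
    by (rule Max_ge) (auto simp: nbhd_self)
  then have "height K x n k \<le> height K x (Suc n) k"
    by simp
  with step show ?case
    by linarith
qed simp

text \<open>Only the height created at the first visit to \<open>k\<close> matters: it is the smallest positive
  height that \<open>k\<close> ever has, and it equals \<open>1\<close> exactly when the whole neighbourhood is still empty.\<close>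

lemma root_iff_first_visited:
  assumes visited: "\<forall>j\<in>nbhd K k. \<exists>n\<ge>1. x n = j" and k: "k \<in> {1..K}"
  shows "k \<in> roots K x \<longleftrightarrow> (\<forall>j \<in> nbhd K k - {k}. first_visit x k < first_visit x j)"
proof -
  define t where "t = first_visit x k - 1"
  have "\<exists>n\<ge>1. x n = k"
    using visited nbhd_self by blast
  then have T: "first_visit x k = Suc t" and at: "x (Suc t) = k"
    using first_visit_pos[of x k] at_first_visit[of x k] by (auto simp: t_def)
  have height_T: "height K x (Suc t) k = Max (height K x t ` nbhd K k) + 1"
    by (simp add: at)
  have "k \<in> roots K x \<longleftrightarrow> height K x (Suc t) k = 1"
  proof
    assume "k \<in> roots K x"
    then obtain i where i: "1 \<le> i" "height K x i k = 1"
      by (auto simp: roots_def)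
    then have "Suc t \<le> i"
      using height_pos_iff[OF \<open>\<exists>n\<ge>1. x n = k\<close>, of K i] T by simp
    then have "height K x (Suc t) k \<le> 1"
      using height_mono[of "Suc t" i K x k] i by simp
    then show "height K x (Suc t) k = 1"
      using height_T by linarith
  next
    assume "height K x (Suc t) k = 1"
    then show "k \<in> roots K x"
      using k unfolding roots_def by (intro CollectI conjI exI[of _ "Suc t"]) auto
  qed
  also have "\<dots> \<longleftrightarrow> Max (height K x t ` nbhd K k) \<le> 0"
    unfolding height_T by simp
  also have "\<dots> \<longleftrightarrow> (\<forall>j\<in>nbhd K k. height K x t j \<le> 0)"
    using nbhd_self[of k K] by (subst Max_le_iff) auto
  also have "\<dots> \<longleftrightarrow> (\<forall>j\<in>nbhd K k. first_visit x k \<le> first_visit x j)"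
  proof (intro ball_cong refl)
    fix j assume "j \<in> nbhd K k"
    then show "height K x t j \<le> 0 \<longleftrightarrow> first_visit x k \<le> first_visit x j"
      using height_pos_iff[of x j K t] visited T by auto
  qed
  also have "\<dots> \<longleftrightarrow> (\<forall>j\<in>nbhd K k - {k}. first_visit x k < first_visit x j)"
    using inj_on_first_visit[OF visited] nbhd_self[of k K]
    by (auto simp: inj_on_def order_le_less)
  finally show ?thesis .
qed

section \<open>Counting gaps\<close>

text \<open>In a set without adjacent elements, \<open>k\<close> and \<open>k + 2\<close> are consecutive as soon as both belong to
  the set, so that the gaps can be counted without reference to the sorted list.\<close>

lemma sum_gaps_of_two:
  fixes S :: "nat set"
  assumes fin: "finite S" and sep: "\<And>k. k \<in> S \<Longrightarrow> Suc k \<notin> S"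
  defines "L \<equiv> sorted_list_of_set S"
  shows "(\<Sum>j = 1..card S - 1. of_bool (L ! j - L ! (j - 1) = 2)) = card {k \<in> S. k + 2 \<in> S}"
proof -
  have len: "length L = card S" and set_L: "set L = S" and less: "sorted_wrt (<) L"
    using fin by (simp_all add: L_def)
  have nth_less: "L ! i < L ! j" if "i < j" "j < card S" for i j
    using sorted_wrt_nth_less[OF less] that len by simp
  have nth_less_iff: "L ! i < L ! j \<longleftrightarrow> i < j" if "i < card S" "j < card S" for i j
    using nth_less[of i j] nth_less[of j i] that by (cases i j rule: linorder_cases) auto
  have nth_in: "L ! i \<in> S" if "i < card S" for i
    using that set_L len by auto
  let ?J = "{j \<in> {1..card S - 1}. L ! j - L ! (j - 1) = 2}"
  have "bij_betw (\<lambda>j. L ! (j - 1)) ?J {k \<in> S. k + 2 \<in> S}"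
  proof (rule bij_betwI')
    fix i j assume "i \<in> ?J" "j \<in> ?J"
    then have ij: "1 \<le> i" "i - 1 < card S" "1 \<le> j" "j - 1 < card S"
      by auto
    then show "L ! (i - 1) = L ! (j - 1) \<longleftrightarrow> i = j"
      using nth_less_iff[of "i - 1" "j - 1"] nth_less_iff[of "j - 1" "i - 1"]
      by (metis le_add_diff_inverse nat_neq_iff)
  next
    fix j assume "j \<in> ?J"
    then have j: "1 \<le> j" "j < card S" "L ! j = L ! (j - 1) + 2"
      using nth_less[of "j - 1" j] by auto
    then show "L ! (j - 1) \<in> {k \<in> S. k + 2 \<in> S}"
      using nth_in[of "j - 1"] nth_in[of j] by auto
  next
    fix k assume "k \<in> {k \<in> S. k + 2 \<in> S}"
    then have "k \<in> set L" "k + 2 \<in> set L"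
      by (simp_all add: set_L)
    then obtain i i' where i: "i < card S" "L ! i = k" and i': "i' < card S" "L ! i' = k + 2"
      unfolding in_set_conv_nth len by blast
    have "i < i'"
      using nth_less_iff[of i i'] i i' by simp
    moreover have "\<not> Suc i < i'"
    proof
      \<comment> \<open>An entry strictly between would be the excluded neighbour \<open>k + 1\<close>.\<close>
      assume *: "Suc i < i'"
      then have "L ! i < L ! Suc i" "L ! Suc i < L ! i'" "L ! Suc i \<in> S"
        using nth_less[of i "Suc i"] nth_less[of "Suc i" i'] nth_in[of "Suc i"] i' by auto
      then have "Suc k \<in> S"
        using i i' by (metis Suc_lessI add_2_eq_Suc' not_less_eq)
      moreover have "k \<in> S"
        using nth_in i by blast
      ultimately show False
        using sep by blast
    qed
    ultimately have "i' = Suc i"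
      by simp
    then show "\<exists>j\<in>?J. k = L ! (j - 1)"
      using i i' by (intro bexI[of _ i']) auto
  qed
  then have "card ?J = card {k \<in> S. k + 2 \<in> S}"
    by (rule bij_betw_same_card)
  then show ?thesis
    by (simp add: Int_def flip: of_bool_def)
qed

text \<open>The strict local minima of \<open>f\<close> inside the window \<open>{a..a + 4}\<close> are at \<open>a + 1\<close> and \<open>a + 3\<close>.\<close>

definition zigzag :: "(nat \<Rightarrow> nat) \<Rightarrow> nat \<Rightarrow> bool" where
  "zigzag f a \<longleftrightarrow> f (a + 1) < f a \<and> f (a + 1) < f (a + 2) \<and> f (a + 3) < f (a + 2) \<and> f (a + 3) < f (a + 4)"

text \<open>The window of the gap between \<open>k\<close> and \<open>k + 2\<close> starts at \<open>k - 1\<close>. Windows in \<open>{1..K}\<close> miss only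
  the two gaps that touch an end of the strip, \<open>k = 1\<close> and \<open>k = K - 2\<close>; the cyclic term of
  \<open>num_gaps\<close> adds at most one more. This accounts for the error \<open>3\<close>.\<close>

lemma num_gaps_near_zigzags:
  assumes K: "3 \<le> K" and visited: "\<forall>k\<in>{1..K}. \<exists>n\<ge>1. x n = k"
  defines "N \<equiv> card {a \<in> {1..K - 4}. zigzag (first_visit x) a}"
  shows "N \<le> num_gaps 1 K x" and "num_gaps 1 K x \<le> N + 3"
proof -
  let ?T = "first_visit x" and ?R = "roots K x"
  have nbhd_subset: "nbhd K k \<subseteq> {1..K}" if "k \<in> {1..K}" for k
    using that K by (auto simp: nbhd_def)
  have root_iff: "k \<in> ?R \<longleftrightarrow> (\<forall>j \<in> nbhd K k - {k}. ?T k < ?T j)" if "k \<in> {1..K}" for k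
    using root_iff_first_visited[of K k x] nbhd_subset[OF that] visited that by blast
  have R_sub: "?R \<subseteq> {1..K}"
    by (auto simp: roots_def)
  then have fin: "finite ?R"
    by (rule finite_subset) simp
  have right: "?T k < ?T (Suc k)" if "k \<in> ?R" "Suc k \<le> K" for k
    using that R_sub root_iff[of k] K by (auto simp: nbhd_def split: if_splits)
  have left: "?T (Suc k) < ?T k" if "Suc k \<in> ?R" "1 \<le> k" for k
    using that R_sub root_iff[of "Suc k"] K by (auto simp: nbhd_def split: if_splits)
  have sep: "Suc k \<notin> ?R" if "k \<in> ?R" for k
    using right[OF that] left[of k] that R_sub by fastforce
  define G where "G = {k \<in> ?R. k + 2 \<in> ?R}"
  have inner: "k \<in> ?R \<longleftrightarrow> ?T k < ?T (k - 1) \<and> ?T k < ?T (k + 1)" if "2 \<le> k" "k < K" for k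
    using that root_iff[of k] by (auto simp: nbhd_def)
  have gaps: "num_gaps 1 K x =
      card G + of_bool (root_loc K x (num_roots K x) - root_loc K x 1 = K - 1 - 1)"
    using sum_gaps_of_two[OF fin sep] by (simp add: num_gaps_def num_roots_def root_loc_def G_def numeral_2_eq_2)
  let ?Z = "Suc ` {a \<in> {1..K - 4}. zigzag ?T a}"
  have zig: "Suc a \<in> G \<longleftrightarrow> zigzag ?T a" if "a \<in> {1..K - 4}" for a
    using that inner[of "a + 1"] inner[of "a + 3"]
    by (auto simp: G_def zigzag_def numeral_eq_Suc)
  have finG: "finite G"
    using fin by (simp add: G_def)
  have card_Z: "card ?Z = N"
    unfolding N_def by (rule card_image) simp
  have "?Z \<subseteq> G"
    using zig by auto
  then have "N \<le> card G"
    using card_mono[OF finG] card_Z by metis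
  then show "N \<le> num_gaps 1 K x"
    using gaps by simp
  have card_insert_two: "card (insert a (insert b Z)) \<le> card Z + 2" if "finite Z"
    for a b :: nat and Z
    using that by (simp add: card_insert_if)
  have "G \<subseteq> insert 1 (insert (K - 2) ?Z)"
  proof
    fix k assume k: "k \<in> G"
    then have "1 \<le> k" "k + 2 \<le> K"
      using R_sub by (auto simp: G_def)
    then consider "k = 1" | "k = K - 2" | "k - 1 \<in> {1..K - 4}" "k = Suc (k - 1)"
      by fastforce
    then show "k \<in> insert 1 (insert (K - 2) ?Z)"
    proof cases
      case 3
      then show ?thesis
        using zig[of "k - 1"] k by (metis (mono_tags, lifting) image_eqI insertI2 mem_Collect_eq)
    qed auto
  qed
  then have "card G \<le> card (insert 1 (insert (K - 2) ?Z))"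
    by (intro card_mono) auto
  also have "\<dots> \<le> N + 2"
    unfolding card_Z[symmetric] using card_insert_two[of ?Z 1 "K - 2"] by simp
  finally have "card G \<le> N + 2" .
  then show "num_gaps 1 K x \<le> N + 3"
    using gaps by simp
qed

section \<open>Exchangeability of the first-visit times\<close>

abbreviation times :: "(nat \<Rightarrow> nat) measure" where
  "times \<equiv> \<Pi>\<^sub>M _\<in>UNIV. count_space UNIV"

lemma time_borel_measurable [measurable]: "(\<lambda>f. f k) \<in> borel_measurable times"
proof -
  have "(\<lambda>f. f k) \<in> times \<rightarrow>\<^sub>M count_space UNIV"
    by (rule measurable_component_singleton) simp
  then show ?thesis
    by (rule measurable_compose) simp
qed

locale uniform_sites = prob_space M for M :: "'a measure" +
  fixes K :: nat and X :: "nat \<Rightarrow> 'a \<Rightarrow> nat"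
  assumes K_pos: "0 < K"
    and indep_X: "indep_vars (\<lambda>_. count_space {1..K}) X UNIV"
    and distr_X: "distr M (count_space {1..K}) (X n) = uniform_count_measure {1..K}"
begin

abbreviation seqs :: "(nat \<Rightarrow> nat) measure" where
  "seqs \<equiv> \<Pi>\<^sub>M _\<in>UNIV. count_space {1..K}"

definition T :: "'a \<Rightarrow> nat \<Rightarrow> nat" where
  "T \<omega> = first_visit (\<lambda>n. X n \<omega>)"

lemma X_measurable [measurable]: "X n \<in> M \<rightarrow>\<^sub>M count_space {1..K}"
  using indep_X by (auto simp: indep_vars_def)

lemma prob_X: "A \<subseteq> {1..K} \<Longrightarrow> prob (X n -` A \<inter> space M) = card A / K"
  using measure_distr[OF X_measurable, of A n] distr_X[of n] K_pos
  by (simp add: measure_uniform_count_measure)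

lemma first_visit_measurable: "first_visit \<in> seqs \<rightarrow>\<^sub>M times"
proof -
  have [measurable]: "Measurable.pred seqs (\<lambda>x. x n = k)" for n k
  proof -
    have "Measurable.pred (count_space {1..K}) (\<lambda>y. y = k)"
      by simp
    then show ?thesis
      by (rule measurable_compose[rotated]) simp
  qed
  have "(\<lambda>x k. first_visit x k) \<in> seqs \<rightarrow>\<^sub>M times"
    unfolding first_visit_def by (rule measurable_abs_UNIV) measurable
  then show ?thesis
    by simp
qed

lemma X_seq_measurable: "(\<lambda>\<omega> n. X n \<omega>) \<in> M \<rightarrow>\<^sub>M seqs"
  by (rule measurable_abs_UNIV) (rule X_measurable)

lemma T_measurable [measurable]: "T \<in> M \<rightarrow>\<^sub>M times"
  unfolding T_def by (rule measurable_compose[OF X_seq_measurable first_visit_measurable])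

text \<open>A permutation of the sites preserves the uniform distribution, and an independent sequence
  is determined in law by its marginals.\<close>

lemma distr_relabelled:
  assumes \<pi>: "\<pi> permutes {1..K}"
  shows "distr M seqs (\<lambda>\<omega> n. \<pi> (X n \<omega>)) = distr M seqs (\<lambda>\<omega> n. X n \<omega>)"
proof -
  let ?C = "count_space {1..K}"
  have \<pi>_meas [measurable]: "\<pi> \<in> ?C \<rightarrow>\<^sub>M ?C"
    using permutes_in_image[OF \<pi>] by auto
  have one: "distr M ?C (\<lambda>\<omega>. \<pi> (X n \<omega>)) = distr M ?C (X n)" for n
  proof -
    have "distr M ?C (\<lambda>\<omega>. \<pi> (X n \<omega>)) = distr (uniform_count_measure {1..K}) ?C \<pi>"
      unfolding distr_X[of n, symmetric] by (subst distr_distr[OF \<pi>_meas X_measurable]) (simp add: comp_def)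
    also have "\<dots> = uniform_count_measure {1..K}"
    proof (rule measure_eqI)
      fix A assume "A \<in> sets (distr (uniform_count_measure {1..K}) ?C \<pi>)"
      then have A: "A \<subseteq> {1..K}"
        by simp
      have pre: "\<pi> -` A \<inter> {1..K} = inv \<pi> ` A"
        using A permutes_in_image[OF permutes_inv[OF \<pi>]]
        by (auto simp: bij_vimage_eq_inv_image[OF permutes_bij[OF \<pi>]])
      have "card (inv \<pi> ` A) = card A"
        using permutes_inj_on[OF permutes_inv[OF \<pi>]] by (rule card_image)
      moreover have "inv \<pi> ` A \<subseteq> {1..K}"
        using pre by blast
      moreover have "\<pi> \<in> uniform_count_measure {1..K} \<rightarrow>\<^sub>M ?C"
        using \<pi>_meas by (simp cong: measurable_cong_sets)
      ultimately show "emeasure (distr (uniform_count_measure {1..K}) ?C \<pi>) A =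
          emeasure (uniform_count_measure {1..K}) A"
        using A pre by (simp add: emeasure_distr space_uniform_count_measure emeasure_uniform_count_measure)
    qed (simp add: sets_uniform_count_measure)
    finally show ?thesis
      by (simp only: distr_X)
  qed
  have "distr M seqs (\<lambda>\<omega>. \<lambda>n\<in>UNIV. \<pi> (X n \<omega>)) = (\<Pi>\<^sub>M n\<in>UNIV. distr M ?C (\<lambda>\<omega>. \<pi> (X n \<omega>)))"
    by (intro indep_vars_iff_distr_eq_PiM[THEN iffD1] indep_vars_compose2[OF indep_X] UNIV_not_empty
        measurable_compose[OF X_measurable] \<pi>_meas)
  also have "\<dots> = (\<Pi>\<^sub>M n\<in>UNIV. distr M ?C (X n))"
    by (simp only: one)
  also have "\<dots> = distr M seqs (\<lambda>\<omega>. \<lambda>n\<in>UNIV. X n \<omega>)"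
    by (intro indep_vars_iff_distr_eq_PiM[THEN iffD1, symmetric] indep_X UNIV_not_empty X_measurable)
  finally show ?thesis
    by (simp only: restrict_UNIV)
qed

text \<open>Permuting the arguments of the first-visit times amounts to relabelling the visited sites by
  the inverse permutation.\<close>

lemma distr_T_permuted:
  assumes \<sigma>: "\<sigma> permutes {1..K}"
  shows "distr M times (\<lambda>\<omega>. T \<omega> \<circ> \<sigma>) = distr M times T"
proof -
  let ?\<pi> = "inv \<sigma>"
  have \<pi>: "?\<pi> permutes {1..K}"
    using \<sigma> by (rule permutes_inv)
  have "T \<omega> \<circ> \<sigma> = first_visit (\<lambda>n. ?\<pi> (X n \<omega>))" for \<omega>
  proof
    fix k
    have "first_visit (\<lambda>n. ?\<pi> (X n \<omega>)) (?\<pi> (\<sigma> k)) = first_visit (\<lambda>n. X n \<omega>) (\<sigma> k)"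
      by (rule first_visit_relabel[OF permutes_inj[OF \<pi>]])
    then show "(T \<omega> \<circ> \<sigma>) k = first_visit (\<lambda>n. ?\<pi> (X n \<omega>)) k"
      by (simp add: T_def permutes_inverses[OF \<sigma>])
  qed
  then have "distr M times (\<lambda>\<omega>. T \<omega> \<circ> \<sigma>) =
      distr M times (\<lambda>\<omega>. first_visit (\<lambda>n. ?\<pi> (X n \<omega>)))"
    by simp
  also have "\<dots> = distr (distr M seqs (\<lambda>\<omega> n. ?\<pi> (X n \<omega>))) times first_visit"
  proof (subst distr_distr[OF first_visit_measurable])
    have "?\<pi> \<in> count_space {1..K} \<rightarrow>\<^sub>M count_space {1..K}"
      using permutes_in_image[OF \<pi>] by auto
    then show "(\<lambda>\<omega> n. ?\<pi> (X n \<omega>)) \<in> M \<rightarrow>\<^sub>M seqs"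
      by (intro measurable_abs_UNIV) (rule measurable_compose[OF X_measurable])
  qed (simp add: comp_def)
  also have "\<dots> = distr M times T"
    unfolding distr_relabelled[OF \<pi>]
    by (subst distr_distr[OF first_visit_measurable X_seq_measurable]) (simp add: comp_def T_def[abs_def])
  finally show ?thesis .
qed

lemma prob_T_permuted:
  assumes \<sigma>: "\<sigma> permutes {1..K}" and Q [measurable]: "Measurable.pred times Q"
  shows "\<P>(\<omega> in M. Q (T \<omega> \<circ> \<sigma>)) = \<P>(\<omega> in M. Q (T \<omega>))"
proof -
  have \<sigma>_meas: "(\<lambda>\<omega>. T \<omega> \<circ> \<sigma>) \<in> M \<rightarrow>\<^sub>M times"
    unfolding comp_def by (rule measurable_abs_UNIV) measurable
  have "\<P>(\<omega> in M. Q (T \<omega> \<circ> \<sigma>)) = measure (distr M times (\<lambda>\<omega>. T \<omega> \<circ> \<sigma>)) {f \<in> space times. Q f}"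
    using Q by (subst measure_distr[OF \<sigma>_meas]) (auto intro!: arg_cong[where f = prob] simp: space_PiM pred_def)
  also have "\<dots> = \<P>(\<omega> in M. Q (T \<omega>))"
    unfolding distr_T_permuted[OF \<sigma>]
    using Q by (subst measure_distr) (auto intro!: arg_cong[where f = prob] simp: space_PiM pred_def)
  finally show ?thesis .
qed

text \<open>The probability that \<open>k\<close> is missed by the first \<open>N\<close> particles is \<open>(1 - 1/K)\<^sup>N\<close>, which tends to
  \<open>0\<close>.\<close>

lemma AE_visited: "AE \<omega> in M. \<forall>k\<in>{1..K}. \<exists>n\<ge>1. X n \<omega> = k"
proof (subst AE_ball_countable)
  show "\<forall>k\<in>{1..K}. AE \<omega> in M. \<exists>n\<ge>1. X n \<omega> = k"
  proof
    fix k assume k: "k \<in> {1..K}"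
    let ?A = "{1..K} - {k}"
    let ?never = "{\<omega> \<in> space M. \<not> (\<exists>n\<ge>1. X n \<omega> = k)}"
    have [measurable]: "Measurable.pred M (\<lambda>\<omega>. X n \<omega> = k)" for n
      by (rule measurable_compose[OF X_measurable]) simp
    have "prob ?never \<le> (1 - 1 / K) ^ N" if "1 \<le> N" for N
    proof -
      have "prob ?never \<le> prob (\<Inter>n\<in>{1..N}. X n -` ?A \<inter> space M)"
      proof (rule finite_measure_mono)
        show "?never \<subseteq> (\<Inter>n\<in>{1..N}. X n -` ?A \<inter> space M)"
          using that measurable_space[OF X_measurable] by fastforce
        show "(\<Inter>n\<in>{1..N}. X n -` ?A \<inter> space M) \<in> events"
          using that by (intro sets.finite_INT measurable_sets[OF X_measurable]) auto
      qed
      also have "\<dots> = (\<Prod>n\<in>{1..N}. prob (X n -` ?A \<inter> space M))"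
        using that by (intro indep_varsD[OF indep_X]) auto
      also have "\<dots> = (1 - 1 / K) ^ N"
      proof -
        have "real (card ?A) = real K - 1"
          using k by (simp add: card_Diff_singleton of_nat_diff)
        then show ?thesis
          using K_pos by (simp only: prob_X[OF Diff_subset]) (simp add: diff_divide_distrib)
      qed
      finally show ?thesis .
    qed
    moreover have "(\<lambda>N. (1 - 1 / K) ^ N) \<longlonglongrightarrow> 0"
      using K_pos by (intro LIMSEQ_realpow_zero) auto
    ultimately have "prob ?never \<le> 0"
      by (intro Lim_bounded2[of _ _ 1]) auto
    then have "prob ?never = 0"
      using measure_nonneg[of M ?never] by linarith
    then show "AE \<omega> in M. \<exists>n\<ge>1. X n \<omega> = k"
      by (subst (asm) prob_eq_0) simp_all
  qed
qed simp

lemma AE_T_inj: "AE \<omega> in M. inj_on (T \<omega>) {1..K}"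
  using AE_visited by eventually_elim (unfold T_def, rule inj_on_first_visit)

end

section \<open>The probability of a zigzag\<close>

definition first_in :: "(nat \<Rightarrow> nat) \<Rightarrow> nat set \<Rightarrow> nat \<Rightarrow> bool" where
  "first_in f S s \<longleftrightarrow> (\<forall>j\<in>S - {s}. f s < f j)"

lemma first_in_measurable [measurable]:
  "finite S \<Longrightarrow> Measurable.pred times (\<lambda>f. first_in f S s)"
  unfolding first_in_def by measurable

lemma zigzag_measurable [measurable]: "Measurable.pred times (\<lambda>f. zigzag f a)"
  unfolding zigzag_def by measurable

text \<open>When \<open>\<sigma>\<close> fixes \<open>s\<close>, this says that a rearrangement of the remaining sites of \<open>S\<close> does not
  affect whether \<open>s\<close> comes first.\<close>

lemma first_in_permuted:
  assumes "\<sigma> permutes S"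
  shows "first_in (f \<circ> \<sigma>) S s \<longleftrightarrow> first_in f S (\<sigma> s)"
proof -
  have "S - {\<sigma> s} = \<sigma> ` (S - {s})"
    using permutes_image[OF assms] permutes_inj[OF assms] by (simp add: image_set_diff)
  then show ?thesis
    by (simp add: first_in_def)
qed

lemma ex1_first_in:
  assumes "inj_on f S" "finite S" "S \<noteq> {}"
  shows "\<exists>!s\<in>S. first_in f S s"
proof -
  obtain s where s: "s \<in> S" "\<And>j. j \<in> S \<Longrightarrow> f s \<le> f j"
    using assms(2,3) by (metis arg_min_if_finite(1) arg_min_least)
  have "f s < f j" if "j \<in> S - {s}" for j
    using s that inj_onD[OF assms(1), of s j] by (auto simp: order_less_le)
  then show ?thesis
    using s by (auto simp: first_in_def intro!: ex1I[of _ s]) (metis DiffI leD singletonD)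
qed

context uniform_sites
begin

text \<open>The events that \<open>u\<close> is the first visited site of \<open>S\<close>, for \<open>u\<close> in \<open>S\<close>, almost surely partition
  the sample space. The transposition of \<open>u\<close> and \<open>s\<close> turns one of them into another and keeps \<open>Q\<close>, so
  \<open>Q\<close> is shared equally among them.\<close>

lemma prob_first_in:
  assumes S: "S \<subseteq> {1..K}" "s \<in> S" and Q [measurable]: "Measurable.pred times Q"
    and inv: "\<And>f u v. u \<in> S \<Longrightarrow> v \<in> S \<Longrightarrow> Q (f \<circ> Transposition.transpose u v) = Q f"
  shows "\<P>(\<omega> in M. first_in (T \<omega>) S s \<and> Q (T \<omega>)) = \<P>(\<omega> in M. Q (T \<omega>)) / card S"
proof -
  have fin [simp]: "finite S"
    using S(1) finite_subset by blast
  let ?p = "\<lambda>u. \<P>(\<omega> in M. first_in (T \<omega>) S u \<and> Q (T \<omega>))"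
  have swap: "?p u = ?p s" if u: "u \<in> S" for u
  proof -
    have perm: "Transposition.transpose u s permutes {1..K}" "Transposition.transpose u s permutes S"
      using u S by (auto intro!: permutes_swap_id)
    have "?p s = \<P>(\<omega> in M. first_in (T \<omega> \<circ> Transposition.transpose u s) S s \<and> Q (T \<omega> \<circ> Transposition.transpose u s))"
      by (rule prob_T_permuted[OF perm(1), symmetric]) simp
    also have "\<dots> = ?p u"
      using inv[OF u S(2)] by (simp add: first_in_permuted[OF perm(2)])
    finally show ?thesis ..
  qed
  have "\<P>(\<omega> in M. Q (T \<omega>)) = (\<Sum>u\<in>S. ?p u)"
  proof (rule prob_sum)
    show "AE \<omega> in M. (\<forall>u\<in>S. first_in (T \<omega>) S u \<and> Q (T \<omega>) \<longrightarrow> Q (T \<omega>)) \<and>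
        (Q (T \<omega>) \<longrightarrow> (\<exists>!u\<in>S. first_in (T \<omega>) S u \<and> Q (T \<omega>)))"
      using AE_T_inj
    proof eventually_elim
      case (elim \<omega>)
      then have "\<exists>!u\<in>S. first_in (T \<omega>) S u"
        using S by (intro ex1_first_in) (auto intro: inj_on_subset)
      then show ?case
        by auto
    qed
  qed simp_all
  also have "\<dots> = card S * ?p s"
    using swap by simp
  finally show ?thesis
    using S by (auto simp: field_simps card_gt_0_iff)
qed

text \<open>A zigzag is split according to which of its two valleys is the lower one. The lower valley
  \<open>r\<close> is then the first visited site of the whole window, and the other one, \<open>s\<close>, is the first in
  its own neighbourhood \<open>S\<close>. That \<open>r\<close> comes first in the window is invariant under permutations of
  \<open>S\<close>, because \<open>r\<close> is not in \<open>S\<close>, so \<open>prob_first_in\<close> applies twice. The event \<open>Q\<close> makes the result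
  usable for a joint probability.\<close>

lemma prob_zigzag:
  assumes a: "1 \<le> a" "a + 4 \<le> K" and Q [measurable]: "Measurable.pred times Q"
    and inv: "\<And>f u v. u \<in> {a..a + 4} \<Longrightarrow> v \<in> {a..a + 4} \<Longrightarrow> Q (f \<circ> Transposition.transpose u v) = Q f"
  shows "\<P>(\<omega> in M. zigzag (T \<omega>) a \<and> Q (T \<omega>)) = 2 / 15 * \<P>(\<omega> in M. Q (T \<omega>))"
proof -
  let ?W = "{a..a + 4}"
  have nested: "\<P>(\<omega> in M. first_in (T \<omega>) S s \<and> first_in (T \<omega>) ?W r \<and> Q (T \<omega>)) =
      \<P>(\<omega> in M. Q (T \<omega>)) / 15"
    if S: "S \<subseteq> ?W" "s \<in> S" "r \<in> ?W - S" "card S = 3" for S s r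
  proof -
    have "first_in (f \<circ> Transposition.transpose u v) ?W r \<longleftrightarrow> first_in f ?W r" if "u \<in> S" "v \<in> S" for f u v
    proof -
      have "Transposition.transpose u v permutes ?W" "Transposition.transpose u v r = r"
        using that S by (auto intro!: permutes_swap_id simp: Transposition.transpose_def)
      then show ?thesis
        by (simp only: first_in_permuted)
    qed
    moreover have "Q (f \<circ> Transposition.transpose u v) = Q f" if "u \<in> S" "v \<in> S" for f u v
      using that S inv by blast
    ultimately have inv_S: "(first_in (f \<circ> Transposition.transpose u v) ?W r \<and> Q (f \<circ> Transposition.transpose u v))
        = (first_in f ?W r \<and> Q f)" if "u \<in> S" "v \<in> S" for f u v
      using that by metis
    have meas: "Measurable.pred times (\<lambda>f. first_in f ?W r \<and> Q f)"
      by measurable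
    have "\<P>(\<omega> in M. first_in (T \<omega>) S s \<and> first_in (T \<omega>) ?W r \<and> Q (T \<omega>)) =
        \<P>(\<omega> in M. first_in (T \<omega>) ?W r \<and> Q (T \<omega>)) / card S"
      using S a by (intro prob_first_in[OF _ _ meas inv_S]) auto
    also have "\<P>(\<omega> in M. first_in (T \<omega>) ?W r \<and> Q (T \<omega>)) = \<P>(\<omega> in M. Q (T \<omega>)) / card ?W"
      using S a by (intro prob_first_in[OF _ _ Q inv]) auto
    finally show ?thesis
      using S by simp
  qed
  let ?L = "\<lambda>\<omega>. first_in (T \<omega>) {a + 2..a + 4} (a + 3) \<and> first_in (T \<omega>) ?W (a + 1) \<and> Q (T \<omega>)"
  let ?R = "\<lambda>\<omega>. first_in (T \<omega>) {a..a + 2} (a + 1) \<and> first_in (T \<omega>) ?W (a + 3) \<and> Q (T \<omega>)"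
  have W: "{a..a + 4} = {a, a + 1, a + 2, a + 3, a + 4}" "{a + 2..a + 4} = {a + 2, a + 3, a + 4}"
      "{a..a + 2} = {a, a + 1, a + 2}"
    by auto
  have "\<P>(\<omega> in M. zigzag (T \<omega>) a \<and> Q (T \<omega>)) = \<P>(\<omega> in M. ?L \<omega>) + \<P>(\<omega> in M. ?R \<omega>)"
  proof -
    have "\<P>(\<omega> in M. zigzag (T \<omega>) a \<and> Q (T \<omega>)) = (\<Sum>b\<in>UNIV. \<P>(\<omega> in M. if b then ?L \<omega> else ?R \<omega>))"
    proof (rule prob_sum)
      have split: "(\<forall>b\<in>UNIV. (if b then l else r) \<longrightarrow> z) \<and> (z \<longrightarrow> (\<exists>!b\<in>UNIV. if b then l else r))"
        if "l \<longleftrightarrow> z \<and> p" "r \<longleftrightarrow> z \<and> \<not> p" for l r z p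
        unfolding that by (cases p) (auto simp: Ex1_def)
      show "AE \<omega> in M.
          (\<forall>b\<in>UNIV. (if b then ?L \<omega> else ?R \<omega>) \<longrightarrow> zigzag (T \<omega>) a \<and> Q (T \<omega>)) \<and>
          (zigzag (T \<omega>) a \<and> Q (T \<omega>) \<longrightarrow> (\<exists>!b\<in>UNIV. if b then ?L \<omega> else ?R \<omega>))"
        using AE_T_inj
      proof eventually_elim
        case (elim \<omega>)
        then have neq: "T \<omega> (a + 1) \<noteq> T \<omega> (a + 3)"
          using a inj_onD[OF elim, of "a + 1" "a + 3"] by auto
        show ?case
        proof (rule split)
          show "?L \<omega> \<longleftrightarrow> (zigzag (T \<omega>) a \<and> Q (T \<omega>)) \<and> T \<omega> (a + 1) < T \<omega> (a + 3)"
            unfolding W by (auto simp: first_in_def zigzag_def numeral_eq_Suc insert_Diff_if)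
          show "?R \<omega> \<longleftrightarrow> (zigzag (T \<omega>) a \<and> Q (T \<omega>)) \<and> \<not> T \<omega> (a + 1) < T \<omega> (a + 3)"
            unfolding W using neq by (auto simp: first_in_def zigzag_def numeral_eq_Suc insert_Diff_if)
        qed
      qed
    qed (simp_all split: if_splits)
    then show ?thesis
      by (simp add: UNIV_bool)
  qed
  also have "\<dots> = 2 / 15 * \<P>(\<omega> in M. Q (T \<omega>))"
    by (subst (1 2) nested) auto
  finally show ?thesis .
qed

end

section \<open>Concentration of the number of zigzags\<close>

context uniform_sites
begin

definition zigzag_count :: "'a \<Rightarrow> real" where
  "zigzag_count \<omega> = (\<Sum>a\<in>{1..K - 4}. indicator {\<omega> \<in> space M. zigzag (T \<omega>) a} \<omega>)"

lemma zigzag_count_measurable [measurable]: "zigzag_count \<in> borel_measurable M"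
  unfolding zigzag_count_def by measurable

lemma prob_single_zigzag:
  assumes "a \<in> {1..K - 4}"
  shows "\<P>(\<omega> in M. zigzag (T \<omega>) a) = 2 / 15"
proof -
  have "1 \<le> a" "a + 4 \<le> K"
    using assms by auto
  then show ?thesis
    using prob_zigzag[of a "\<lambda>_. True"] by (simp add: prob_space)
qed

text \<open>A zigzag at \<open>b\<close> ignores the order within a window disjoint from its own.\<close>

lemma prob_two_zigzags:
  assumes "a \<in> {1..K - 4}" "b \<in> {1..K - 4}" and apart: "a + 5 \<le> b \<or> b + 5 \<le> a"
  shows "\<P>(\<omega> in M. zigzag (T \<omega>) a \<and> zigzag (T \<omega>) b) = (2 / 15)\<^sup>2"
proof -
  have inv: "zigzag (f \<circ> Transposition.transpose u v) b = zigzag f b"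
    if "u \<in> {a..a + 4}" "v \<in> {a..a + 4}" for f u v
  proof -
    have "Transposition.transpose u v j = j" if "j \<in> {b..b + 4}" for j
      using that \<open>u \<in> _\<close> \<open>v \<in> _\<close> apart by (auto simp: Transposition.transpose_def)
    then show ?thesis
      by (simp add: zigzag_def)
  qed
  have "1 \<le> a" "a + 4 \<le> K"
    using assms by auto
  then have "\<P>(\<omega> in M. zigzag (T \<omega>) a \<and> zigzag (T \<omega>) b) = 2 / 15 * \<P>(\<omega> in M. zigzag (T \<omega>) b)"
    by (intro prob_zigzag zigzag_measurable inv)
  then show ?thesis
    using prob_single_zigzag[OF assms(2)] by (simp add: power2_eq_square)
qed

lemma expectation_zigzag_count: "expectation zigzag_count = 2 / 15 * real (K - 4)"
proof -
  have "expectation zigzag_count = (\<Sum>a\<in>{1..K - 4}. \<P>(\<omega> in M. zigzag (T \<omega>) a))"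
    unfolding zigzag_count_def by (subst Bochner_Integration.integral_sum) (simp_all add: less_top[symmetric])
  also have "\<dots> = (\<Sum>a\<in>{1..K - 4}. 2 / 15)"
    by (intro sum.cong refl prob_single_zigzag)
  also have "\<dots> = 2 / 15 * real (K - 4)"
    by simp
  finally show ?thesis .
qed

text \<open>In the double sum of covariances only the pairs of overlapping windows, those with
  \<open>b \<in> {a - 4..a + 4}\<close>, contribute, and each contributes at most \<open>1\<close>.\<close>

lemma variance_zigzag_count: "variance zigzag_count \<le> 9 * real K"
proof -
  let ?I = "{1..K - 4}" and ?p = "2 / 15 :: real"
  define Z where "Z a = {\<omega> \<in> space M. zigzag (T \<omega>) a}" for a
  have Z_meas [measurable]: "Z a \<in> events" for a
    unfolding Z_def by measurable
  define Y :: "nat \<Rightarrow> 'a \<Rightarrow> real" where "Y a \<omega> = indicator (Z a) \<omega> - ?p" for a \<omega>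
  have Y_meas [measurable]: "Y a \<in> borel_measurable M" for a
    unfolding Y_def by measurable
  have Y_bound: "\<bar>Y a \<omega> * Y b \<omega>\<bar> \<le> 1" for a b \<omega>
  proof -
    have "\<bar>Y a \<omega>\<bar> \<le> 1" "\<bar>Y b \<omega>\<bar> \<le> 1"
      by (auto simp: Y_def indicator_def)
    then show ?thesis
      by (simp add: abs_mult mult_le_one)
  qed
  have int_YY: "integrable M (\<lambda>\<omega>. Y a \<omega> * Y b \<omega>)" for a b
    using Y_bound by (intro integrable_const_bound[of _ 1]) auto
  have cov: "expectation (\<lambda>\<omega>. Y a \<omega> * Y b \<omega>) \<le> indicator {a - 4..a + 4} b"
    if ab: "a \<in> ?I" "b \<in> ?I" for a b
  proof (cases "b \<in> {a - 4..a + 4}")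
    case True
    have "expectation (\<lambda>\<omega>. Y a \<omega> * Y b \<omega>) \<le> expectation (\<lambda>\<omega>. 1)"
      using Y_bound[of a _ b] by (intro integral_mono int_YY) (auto simp: abs_le_iff)
    then show ?thesis
      using True by (simp add: prob_space)
  next
    case False
    have prob_Z: "prob (Z c) = ?p" if "c \<in> ?I" for c
      using prob_single_zigzag[OF that] by (simp add: Z_def)
    have ZZ: "Z a \<inter> Z b = {\<omega> \<in> space M. zigzag (T \<omega>) a \<and> zigzag (T \<omega>) b}"
      by (auto simp: Z_def)
    have prob_ZZ: "prob (Z a \<inter> Z b) = ?p\<^sup>2"
    proof -
      have "a + 5 \<le> b \<or> b + 5 \<le> a"
        using False by auto
      then show ?thesis
        using prob_two_zigzags[OF ab] ZZ by simp
    qed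
    have "(\<lambda>\<omega>. Y a \<omega> * Y b \<omega>) =
        (\<lambda>\<omega>. indicator (Z a \<inter> Z b) \<omega> - ?p * indicator (Z a) \<omega> - ?p * indicator (Z b) \<omega> + ?p\<^sup>2)"
      by (auto simp: Y_def fun_eq_iff indicator_def power2_eq_square)
    then have "expectation (\<lambda>\<omega>. Y a \<omega> * Y b \<omega>) = prob (Z a \<inter> Z b) - ?p * prob (Z a) - ?p * prob (Z b) + ?p\<^sup>2"
      by (simp add: prob_space less_top[symmetric])
    also have "\<dots> = 0"
      unfolding prob_ZZ prob_Z[OF ab(1)] prob_Z[OF ab(2)] by (simp add: power2_eq_square)
    finally show ?thesis
      by simp
  qed
  have "(zigzag_count \<omega> - expectation zigzag_count)\<^sup>2 = (\<Sum>a\<in>?I. \<Sum>b\<in>?I. Y a \<omega> * Y b \<omega>)" for \<omega>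
  proof -
    have "zigzag_count \<omega> - expectation zigzag_count = (\<Sum>a\<in>?I. Y a \<omega>)"
      unfolding expectation_zigzag_count by (simp add: zigzag_count_def Y_def Z_def sum_subtractf)
    then show ?thesis
      by (simp add: power2_eq_square sum_product)
  qed
  then have "variance zigzag_count = (\<Sum>a\<in>?I. \<Sum>b\<in>?I. expectation (\<lambda>\<omega>. Y a \<omega> * Y b \<omega>))"
    using int_YY by simp
  also have "\<dots> \<le> (\<Sum>a\<in>?I. \<Sum>b\<in>?I. indicator {a - 4..a + 4} b)"
    using cov by (intro sum_mono) auto
  also have "\<dots> \<le> (\<Sum>a\<in>?I. 9)"
  proof (intro sum_mono)
    fix a
    have "card (?I \<inter> {a - 4..a + 4}) \<le> card {a - 4..a + 4}"
      by (intro card_mono) auto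
    also have "\<dots> \<le> 9"
      by simp
    finally have "real (card (?I \<inter> {a - 4..a + 4})) \<le> 9"
      by simp
    then show "(\<Sum>b\<in>?I. indicator {a - 4..a + 4} b) \<le> (9 :: real)"
      by (simp add: indicator_def del: atLeastAtMost_iff)
  qed
  also have "\<dots> \<le> 9 * real K"
    by simp
  finally show ?thesis .
qed

text \<open>Multiplied by \<open>15\<close>, the boundary error \<open>3\<close> and the difference between \<open>2/15 (K - 4)\<close> and
  \<open>2/15 K\<close> add up to \<open>45 + 8 = 53\<close>. Once this is at most \<open>\<epsilon> K\<close>, a deviation of the ratio by more than
  \<open>\<epsilon>\<close>, that is of \<open>15 D\<close> by more than \<open>2 \<epsilon> K\<close>, leaves a deviation of at least \<open>\<epsilon> K / 15\<close> for the
  number of zigzags.\<close>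

lemma prob_gaps_deviation_le:
  assumes K: "4 \<le> K" and \<epsilon>: "0 < \<epsilon>" "53 \<le> \<epsilon> * real K"
  shows "\<P>(\<omega> in M. \<bar>15 * real (num_gaps 1 K (\<lambda>n. X n \<omega>)) / (2 * real K) - 1\<bar> > \<epsilon>)
    \<le> 2025 / (\<epsilon>\<^sup>2 * real K)"
proof -
  let ?\<delta> = "\<epsilon> * real K / 15"
  have "\<P>(\<omega> in M. \<bar>15 * real (num_gaps 1 K (\<lambda>n. X n \<omega>)) / (2 * real K) - 1\<bar> > \<epsilon>)
    \<le> \<P>(\<omega> in M. \<bar>zigzag_count \<omega> - expectation zigzag_count\<bar> \<ge> ?\<delta>)"
  proof (rule finite_measure_mono_AE)
    show "AE \<omega> in M. \<omega> \<in> {\<omega> \<in> space M. \<bar>15 * real (num_gaps 1 K (\<lambda>n. X n \<omega>)) / (2 * real K) - 1\<bar> > \<epsilon>}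
        \<longrightarrow> \<omega> \<in> {\<omega> \<in> space M. \<bar>zigzag_count \<omega> - expectation zigzag_count\<bar> \<ge> ?\<delta>}"
      using AE_visited
    proof eventually_elim
      case (elim \<omega>)
      let ?D = "real (num_gaps 1 K (\<lambda>n. X n \<omega>))"
      have "\<bar>zigzag_count \<omega> - expectation zigzag_count\<bar> \<ge> ?\<delta>"
        if \<omega>: "\<omega> \<in> space M" and dev: "\<bar>15 * ?D / (2 * real K) - 1\<bar> > \<epsilon>"
      proof -
        have "zigzag_count \<omega> = card {a \<in> {1..K - 4}. zigzag (first_visit (\<lambda>n. X n \<omega>)) a}"
          using \<omega> by (simp add: zigzag_count_def T_def indicator_def Int_def)
        then have near: "zigzag_count \<omega> \<le> ?D" "?D \<le> zigzag_count \<omega> + 3"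
          using num_gaps_near_zigzags[OF _ elim] K by simp_all
        have "15 * ?D / (2 * real K) - 1 = (15 * ?D - 2 * real K) / (2 * real K)"
          using K by (simp add: field_simps)
        then have "\<epsilon> * (2 * real K) < \<bar>15 * ?D - 2 * real K\<bar>"
          using dev K by (simp add: pos_less_divide_eq)
        moreover have "expectation zigzag_count = 2 / 15 * (real K - 4)"
          using K by (simp add: expectation_zigzag_count of_nat_diff)
        ultimately show ?thesis
          using near \<epsilon>(2) by (auto simp: abs_if split: if_splits)
      qed
      then show ?case
        by simp
    qed
  qed simp
  also have "\<dots> \<le> variance zigzag_count / ?\<delta>\<^sup>2"
  proof (rule Chebyshev_inequality)
    have "\<bar>zigzag_count \<omega>\<bar> \<le> real K" for \<omega>
    proof -
      have "\<bar>zigzag_count \<omega>\<bar> \<le> (\<Sum>a\<in>{1..K - 4}. 1)"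
        unfolding zigzag_count_def by (rule order_trans[OF sum_abs sum_mono]) (simp add: indicator_def)
      then show ?thesis
        by simp
    qed
    then have "\<bar>zigzag_count \<omega> ^ 2\<bar> \<le> real K ^ 2" for \<omega>
      by (simp add: abs_le_square_iff[symmetric])
    then show "integrable M (\<lambda>\<omega>. zigzag_count \<omega> ^ 2)"
      by (intro integrable_const_bound[of _ "real K ^ 2"]) auto
  qed (use K \<epsilon> in auto)
  also have "\<dots> \<le> 9 * real K / ?\<delta>\<^sup>2"
    by (intro divide_right_mono variance_zigzag_count) simp
  also have "\<dots> = 2025 / (\<epsilon>\<^sup>2 * real K)"
    using K \<epsilon> by (simp add: field_simps power2_eq_square)
  finally show ?thesis .
qed

end

theorem corollary4:
  fixes M :: "nat \<Rightarrow> 'a measure" and X :: "nat \<Rightarrow> nat \<Rightarrow> 'a \<Rightarrow> nat"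
  assumes prob: "\<And>K. K \<ge> 3 \<Longrightarrow> prob_space (M K)"
    and indep: "\<And>K. K \<ge> 3 \<Longrightarrow>
      prob_space.indep_vars (M K) (\<lambda>_. count_space {1..K}) (X K) UNIV"
    and unif: "\<And>K n. K \<ge> 3 \<Longrightarrow>
      distr (M K) (count_space {1..K}) (X K n) = uniform_count_measure {1..K}"
  shows "\<forall>\<epsilon>>0. (\<lambda>K. measure (M K)
      {\<omega> \<in> space (M K). \<bar>15 * real (num_gaps 1 K (\<lambda>n. X K n \<omega>)) / (2 * real K) - 1\<bar> > \<epsilon>})
    \<longlonglongrightarrow> 0"
proof (intro allI impI)
  fix \<epsilon> :: real
  assume \<epsilon>: "0 < \<epsilon>"
  let ?P = "\<lambda>K. measure (M K)
      {\<omega> \<in> space (M K). \<bar>15 * real (num_gaps 1 K (\<lambda>n. X K n \<omega>)) / (2 * real K) - 1\<bar> > \<epsilon>}"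
  have bound: "?P K \<le> 2025 / (\<epsilon>\<^sup>2 * real K)" if K: "4 \<le> K" "53 / \<epsilon> \<le> real K" for K
  proof -
    interpret prob_space "M K"
      using prob K by simp
    interpret uniform_sites "M K" K "X K"
      using indep[of K] unif[of K] K by unfold_locales auto
    show ?thesis
      using prob_gaps_deviation_le[of \<epsilon>] K \<epsilon> by (simp add: field_simps)
  qed
  have large: "eventually (\<lambda>K. 4 \<le> K \<and> 53 / \<epsilon> \<le> real K) sequentially"
    using filterlim_real_sequentially unfolding filterlim_at_top
    by (intro eventually_conj eventually_ge_at_top) blast
  have upper: "eventually (\<lambda>K. ?P K \<le> 2025 / (\<epsilon>\<^sup>2 * real K)) sequentially"
    using large by eventually_elim (use bound in blast)
  have lower: "eventually (\<lambda>K. 0 \<le> ?P K) sequentially"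
    by simp
  have "(\<lambda>K. 2025 / (\<epsilon>\<^sup>2 * real K)) \<longlonglongrightarrow> 0"
    by (intro tendsto_divide_0[OF tendsto_const] filterlim_at_top_imp_at_infinity
        filterlim_tendsto_pos_mult_at_top[OF tendsto_const] filterlim_real_sequentially)
       (use \<epsilon> in simp)
  then show "?P \<longlonglongrightarrow> 0"
    by (rule tendsto_sandwich[OF lower upper tendsto_const])
qed

end
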